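(* Let $s_1, s_2$ be two odd squarefree positive integers greater than $1$, with $\gcd(s_1,s_2)=1$, such that $s_1 s_2 = p_1 p_2\cdots p_n$ with $n\ge 2$, where $p_1,\dots,p_n$ are primes with $p_1\equiv 5 \pmod 8$ and $p_2\equiv\cdots\equiv p_n\equiv 1 \pmod 8$. Assume in addition that: if $s_1\equiv 1\pmod 8$, then $s_1$ is a quadratic nonresidue of every divisor $d>1$ of $s_2$ (including $d=s_2$); and if $s_2\equiv 1\pmod 8$, then $s_2$ is a quadratic nonresidue of every divisor $d>1$ of $s_1$ (including $d=s_1$). Then there are no positive integers $x,y,z$ with $\gcd(s_1x,s_2y)=1$ and $$s_1^2x^4+s_2^2y^4=z^2.$$
   Context: For an integer $a$ and an integer $d>1$ (prime or composite) with $\gcd(a,d)=1$, "$a$ is a quadratic nonresidue of $d$" means that the congruence $t^2\equiv a\pmod d$ has no integer solution $t$. *)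

theory Defs
  imports "HOL-Number_Theory.Number_Theory" "HOL-Computational_Algebra.Squarefree"
begin

text \<open>
  The paper speaks of a quadratic nonresidue only when \<open>a\<close> is coprime to a modulus
  \<open>d > 1\<close>, prime or composite. Note the argument order of \<^const>\<open>QuadRes\<close>, which takes
  the modulus first.
\<close>

definition quadratic_nonresidue :: "int \<Rightarrow> int \<Rightarrow> bool" where
  "quadratic_nonresidue a d \<longleftrightarrow> d > 1 \<and> coprime a d \<and> \<not> QuadRes d a"

end

theory Submission
  imports Defs "HOL-Computational_Algebra.Nth_Powers"
begin

text \<open>
  One of \<open>s1 x\<close>, \<open>s2 y\<close> is even, and the hypotheses are symmetric, so let \<open>s2 y\<close> be even. Then
  \<open>s1 x\<^sup>2 = m\<^sup>2 - k\<^sup>2\<close> and \<open>s2 y\<^sup>2 = 2 m k\<close> with \<open>m\<close> odd, \<open>k\<close> even and coprime. Since every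
  divisor of \<open>s1 s2\<close> is \<open>1\<close> modulo \<open>4\<close>, each of the coprime factors \<open>m - k\<close>, \<open>m + k\<close>, \<open>m\<close> and
  \<open>k/2\<close> is such a divisor times a square; this forces \<open>8 dvd k\<close>, hence
  \<open>s1 \<equiv> s1 x\<^sup>2 = (m - k) (m + k) \<equiv> 1\<close> modulo \<open>8\<close>. But a prime factor \<open>q\<close> of \<open>s2\<close> divides \<open>m\<close> or
  \<open>k\<close>, so \<open>s1 x\<^sup>2\<close> is \<open>- k\<^sup>2\<close> or \<open>m\<^sup>2\<close> modulo \<open>q\<close>. Both are squares because \<open>q \<equiv> 1\<close> modulo \<open>4\<close>,
  contradicting the nonresidue hypothesis.
\<close>

lemma coprime_mult_eq_square_int:
  fixes a b w :: int
  assumes "coprime a b" "a * b = w\<^sup>2" "a > 0" "b > 0"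
  obtains u where "a = u\<^sup>2"
proof -
  have "nat a * nat b = (nat \<bar>w\<bar>)\<^sup>2"
    using assms by (metis abs_ge_zero nat_mult_distrib nat_power_eq order_less_imp_le power2_abs)
  moreover have "coprime (nat a) (nat b)"
    using assms by (metis coprime_int_iff int_nat_eq order_less_imp_le)
  ultimately have "is_nth_power 2 (nat a)"
    using assms is_nth_power_mult_coprime_natD(1)[of "nat a" "nat b" 2]
    by (metis is_nth_power_nth_power zero_less_nat_eq)
  then obtain v where "nat a = v\<^sup>2"
    by (auto elim: is_nth_powerE)
  then have "a = (int v)\<^sup>2"
    using assms by (metis int_nat_eq of_nat_power order_less_imp_le)
  then show ?thesis ..
qed

text \<open>Take \<open>c = gcd a s\<close>. After cancelling \<open>c\<close>, the rest of
  \<open>s\<close> is coprime to the rest of \<open>a\<close>, so it divides \<open>b\<close>; what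
  remains is a product of two coprime numbers equal to \<open>w\<^sup>2\<close>.\<close>

lemma coprime_factor_eq_divisor_times_square:
  fixes a b s w :: int
  assumes "coprime a b" "a * b = s * w\<^sup>2" "a > 0" "b > 0" "s > 0"
  obtains c u where "c dvd s" "c > 0" "a = c * u\<^sup>2"
proof -
  define c where "c = gcd a s"
  have c: "c > 0" using assms by (simp add: c_def)
  obtain a' s' where as: "a = a' * c" "s = s' * c" "coprime a' s'"
    unfolding c_def by (metis assms(3) gcd_coprime_exists gcd_eq_0_iff less_irrefl)
  have eq: "a' * b = s' * w\<^sup>2"
    using assms(2) c unfolding as by (simp add: mult.commute mult.left_commute)
  then have "s' dvd b"
    using as(3) by (metis coprime_commute coprime_dvd_mult_right_iff dvd_triv_left)
  then obtain b' where b': "b = s' * b'" ..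
  have s': "s' > 0" "a' > 0" using as assms c by (auto simp: zero_less_mult_iff)
  then have "a' * b' = w\<^sup>2" "b' > 0"
    using eq assms(4) unfolding b' by (auto simp: zero_less_mult_iff)
  moreover have "coprime a' b'"
    using assms(1) unfolding as b' by simp
  ultimately obtain u where "a' = u\<^sup>2"
    using s' coprime_mult_eq_square_int by metis
  then show ?thesis
    using that[of c u] c as by (simp add: mult.commute)
qed

text \<open>Since \<open>a\<close> and \<open>c\<close> are odd, \<open>c - a = 2 * d\<close> and
  \<open>c + a = 2 * e\<close>. The halves are coprime with product the square of
  \<open>b / 2\<close>, so both are squares.\<close>

lemma primitive_pythagorean_even:
  fixes a b c :: int
  assumes "a\<^sup>2 + b\<^sup>2 = c\<^sup>2" "coprime a b" "even b" "a > 0" "b > 0" "c > 0"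
  obtains m k where "m > k" "k > 0" "coprime m k" "odd (m + k)" "a = m\<^sup>2 - k\<^sup>2" "b = 2 * m * k"
proof -
  have "odd a" using assms(2,3) by auto
  then have "odd c" using assms(1,3) by (metis even_add even_power pos2)
  obtain d where d: "c - a = 2 * d" using \<open>odd a\<close> \<open>odd c\<close> by (metis dvdE odd_even_add even_diff)
  obtain b' where b': "b = 2 * b'" using assms(3) ..
  define e where "e = a + d"
  have ae: "a = e - d" "c = e + d" using d by (auto simp: e_def)
  have de: "e * d = b'\<^sup>2"
    using assms(1) unfolding ae b' by (simp add: power2_eq_square algebra_simps)
  \<comment> \<open>A common divisor \<open>g\<close> has its square dividing
    \<open>b'\<^sup>2\<close>, hence divides \<open>b\<close>; it also divides
    \<open>a = e - d\<close>.\<close>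
  have cp: "coprime e d"
  proof (rule coprimeI)
    fix g assume g: "g dvd e" "g dvd d"
    have "g\<^sup>2 dvd b'\<^sup>2" using g de by (metis mult_dvd_mono power2_eq_square)
    then have "g dvd b" unfolding b' by (simp add: dvd_mult)
    moreover have "g dvd a" unfolding ae using g by simp
    ultimately show "is_unit g" using assms(2) by (meson coprime_common_divisor)
  qed
  have "a < c"
  proof (rule power2_less_imp_less)
    show "a\<^sup>2 < c\<^sup>2" unfolding assms(1)[symmetric] using assms(5) by simp
  qed (use assms(6) in simp)
  then have d0: "d > 0" using d by simp
  then have e0: "e > 0" using assms by (simp add: e_def)
  obtain m0 where m0: "e = m0\<^sup>2" using coprime_mult_eq_square_int[OF cp de e0 d0] .
  obtain k0 where k0: "d = k0\<^sup>2"
    using coprime_mult_eq_square_int[of d e b'] cp de e0 d0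
    by (metis coprime_commute mult.commute)
  define m k where "m = \<bar>m0\<bar>" and "k = \<bar>k0\<bar>"
  have mk: "e = m\<^sup>2" "d = k\<^sup>2" "m \<ge> 0" "k > 0" using m0 k0 d0 by (auto simp: m_def k_def)
  have "a = m\<^sup>2 - k\<^sup>2" using ae mk by simp
  moreover have "m > k"
    using \<open>a > 0\<close> calculation mk(3) by (auto intro: power2_less_imp_less[of k m])
  moreover have "coprime m k" using cp mk by simp
  moreover have "odd (m + k)" using \<open>odd a\<close> calculation(1) by simp
  moreover have "b = 2 * m * k"
  proof -
    have "b\<^sup>2 = (2 * m * k)\<^sup>2" using de unfolding b' mk by (simp add: power_mult_distrib)
    then show ?thesis using assms mk by (simp add: power2_eq_iff_nonneg)
  qed
  ultimately show ?thesis using that mk by blast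
qed

text \<open>The class of 1 is closed under multiplication, so it survives building \<open>n\<close>
  up from its prime factors.\<close>

lemma cong_1_if_prime_divisors_cong_1:
  fixes n k :: int
  assumes "n > 0" "\<And>q. prime q \<Longrightarrow> q dvd n \<Longrightarrow> [q = 1] (mod k)"
  shows "[n = 1] (mod k)"
  using assms
proof (induction n rule: prime_divisors_induct)
  case (unit x)
  then show ?case by (simp add: zdvd1_eq)
next
  case (factor p x)
  have "x > 0" using factor prime_gt_0_int[of p] by (simp add: zero_less_mult_iff)
  then have "[x = 1] (mod k)" using factor by simp
  moreover have "[p = 1] (mod k)" using factor by simp
  ultimately show ?case using cong_mult by fastforce
qed simp

text \<open>Euler's criterion applies, and the exponent \<open>(q - 1) div 2\<close> is
  even.\<close>

lemma QuadRes_minus_one: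
  fixes q :: int
  assumes "prime q" "[q = 1] (mod 4)"
  shows "QuadRes q (-1)"
proof -
  have "q > 1" using assms(1) by (rule prime_gt_1_int)
  have q4: "q mod 4 = 1" using assms(2) by (simp add: cong_def)
  then have q2: "q > 2" using \<open>q > 1\<close> by (cases "q = 2") auto
  have "int (nat q mod 4) = 1" using q4 q2 by (simp add: zmod_int)
  then have "nat q mod 4 = 1" by linarith
  then obtain j where "nat q = 4 * j + 1" by (metis mult_div_mod_eq)
  then have ev: "even ((nat q - 1) div 2)" by simp
  have "[Legendre (-1) (nat q) = (-1) ^ ((nat q - 1) div 2)] (mod (nat q))"
    using assms(1) q2 by (intro euler_criterion) auto
  then have L: "[Legendre (-1) q = 1] (mod q)" using ev q2 by simp
  show ?thesis
  proof (rule ccontr)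
    assume "\<not> QuadRes q (-1)"
    then have "Legendre (-1) q \<in> {0, -1}" by (simp add: Legendre_def)
    \<comment> \<open>A Legendre symbol of 0 or -1 is congruent to 1 only if \<open>q\<close>
      divides 1 or 2.\<close>
    then have "q dvd 1 \<or> q dvd 2" using L by (auto simp: cong_iff_dvd_diff)
    then show False using q2 zdvd_imp_le[of q 1] zdvd_imp_le[of q 2] by auto
  qed
qed

text \<open>Multiplying a root of \<open>a * x\<^sup>2\<close> by an inverse \<open>v\<close> of
  \<open>x\<close> gives a root of \<open>a\<close>.\<close>

lemma QuadRes_mult_square_cancel:
  assumes "QuadRes q (a * x\<^sup>2)" "coprime x q"
  shows "QuadRes q a"
proof -
  obtain t where t: "[t\<^sup>2 = a * x\<^sup>2] (mod q)" using assms(1) by (auto simp: QuadRes_def)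
  obtain v where v: "[x * v = 1] (mod q)" using assms(2) cong_solve_coprime_int by blast
  have "[(t * v)\<^sup>2 = a * x\<^sup>2 * v\<^sup>2] (mod q)"
    unfolding power_mult_distrib by (rule cong_scalar_right[OF t])
  also have "a * x\<^sup>2 * v\<^sup>2 = a * (x * v)\<^sup>2" by (simp add: power_mult_distrib)
  also have "[a * (x * v)\<^sup>2 = a * 1\<^sup>2] (mod q)"
    by (intro cong_scalar_left cong_pow v)
  finally show ?thesis by (auto simp: QuadRes_def)
qed

lemma odd_square_mod_8:
  fixes x :: int
  assumes "odd x"
  shows "[x\<^sup>2 = 1] (mod 8)"
proof -
  obtain j where j: "x = 2 * j + 1" using assms by (rule oddE)
  have "even (j * (j + 1))" by simp
  then obtain i where "j * (j + 1) = 2 * i" by (rule evenE)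
  then have "x\<^sup>2 - 1 = 8 * i" unfolding j by (simp add: power2_eq_square algebra_simps)
  then show ?thesis by (simp add: cong_iff_dvd_diff)
qed

text \<open>The hypotheses on the coefficients hold for \<open>s1\<close>, \<open>s2\<close> in
  either order, so this covers both parity cases. Evenness of \<open>y\<close> forces
  \<open>a\<close> to be 1 modulo 8, which makes \<open>nonres\<close> available.\<close>

lemma no_solution_even:
  fixes a b x y z :: int
  assumes pos: "a > 0" "b > 1" "x > 0" "y > 0" "z > 0"
    and ab: "odd a" "odd b"
    and primes: "\<And>q. prime q \<Longrightarrow> q dvd a * b \<Longrightarrow> [q = 1] (mod 4)"
    and nonres: "[a = 1] (mod 8) \<Longrightarrow> (\<forall>d. d > 1 \<and> d dvd b \<longrightarrow> quadratic_nonresidue a d)"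
    and cop: "coprime (a * x) (b * y)"
    and "even y"
    and eq: "a\<^sup>2 * x ^ 4 + b\<^sup>2 * y ^ 4 = z\<^sup>2"
  shows False
proof -
  have "(a * x\<^sup>2)\<^sup>2 + (b * y\<^sup>2)\<^sup>2 = z\<^sup>2"
    using eq by (simp add: power_mult_distrib flip: power_mult)
  moreover have "coprime (a * x\<^sup>2) (b * y\<^sup>2)" using cop by simp
  ultimately obtain m k where mk: "m > k" "k > 0" "coprime m k" "odd (m + k)"
      "a * x\<^sup>2 = m\<^sup>2 - k\<^sup>2" "b * y\<^sup>2 = 2 * m * k"
    using primitive_pythagorean_even[of "a * x\<^sup>2" "b * y\<^sup>2" z] pos \<open>even y\<close>
    by (smt (verit) dvd_mult even_power mult_pos_pos pos2 zero_less_power)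
  have "odd x" using cop \<open>even y\<close> by auto
  have div4: "[c = 1] (mod 4)" if "c > 0" "c dvd a * b" for c
    using that(1)
  proof (rule cong_1_if_prime_divisors_cong_1)
    show "[q = 1] (mod 4)" if "prime q" "q dvd c" for q
      using primes[OF that(1) dvd_trans[OF that(2) \<open>c dvd a * b\<close>]] .
  qed
  \<comment> \<open>Write \<open>g = c * u\<^sup>2\<close> with \<open>c\<close> dividing
    \<open>s\<close>. As \<open>g\<close> is odd, so is \<open>u\<close>, and both factors are 1
    modulo 4.\<close>
  have fac4: "[g = 1] (mod 4)"
    if g: "coprime g h" "g * h = s * w\<^sup>2" "g > 0" "h > 0" "s > 0" "s dvd a * b" "odd g" for g h s w
  proof -
    obtain c u where c: "c dvd s" "c > 0" "g = c * u\<^sup>2"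
      by (rule coprime_factor_eq_divisor_times_square[OF g(1-5)])
    have "[u\<^sup>2 = 1] (mod 4)"
      using cong_dvd_modulus[OF odd_square_mod_8[of u], of 4] g(7) c(3) by simp
    moreover have "[c = 1] (mod 4)" using div4 c(1,2) g(6) dvd_trans by blast
    ultimately show ?thesis unfolding c(3) using cong_mult[of c 1 4 "u\<^sup>2" 1] by simp
  qed
  have cpm: "coprime (m - k) (m + k)"
  proof (rule coprimeI)
    fix g assume g: "g dvd m - k" "g dvd m + k"
    have "odd g" using g(2) mk(4) by (meson dvd_trans)
    have "g dvd (m + k) + (m - k)" "g dvd (m + k) - (m - k)" using g by (blast intro: dvd_add dvd_diff)+
    then have "g dvd 2 * m" "g dvd 2 * k" by simp_all
    then have "g dvd m" "g dvd k" using \<open>odd g\<close> by (simp_all add: coprime_dvd_mult_right_iff)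
    then show "is_unit g" using mk(3) by (meson coprime_common_divisor)
  qed
  have fac: "(m - k) * (m + k) = a * x\<^sup>2"
    using mk(5) by (simp add: power2_eq_square algebra_simps)
  have minus: "[m - k = 1] (mod 4)"
    using fac4[OF cpm fac] mk pos by simp
  have plus: "[m + k = 1] (mod 4)"
    using fac4[of "m + k" "m - k" a x] cpm fac mk pos by (simp add: mult.commute coprime_commute)
  have mod4: "(m - k) mod 4 = 1" "(m + k) mod 4 = 1"
    using minus plus by (simp_all add: cong_def)
  \<comment> \<open>The sum \<open>2 * m\<close> of the two factors is 2 modulo 4, and their
    difference \<open>2 * k\<close> is 0 modulo 4.\<close>
  then have "even k" "odd m" by presburger+
  then obtain k' where k': "k = 2 * k'" by blast
  obtain y' where y': "y = 2 * y'" using \<open>even y\<close> by blast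
  \<comment> \<open>Cancelling 4 from \<open>b * y\<^sup>2 = 2 * m * k\<close> gives a second
    coprime factorisation to which \<open>fac4\<close> applies.\<close>
  have mk': "m * k' = b * y'\<^sup>2" "coprime m k'" "k' > 0" "m > 0"
    using mk unfolding k' y' by (auto simp: power2_eq_square)
  have "[m = 1] (mod 4)"
    using fac4[OF mk'(2,1,4,3)] pos \<open>odd m\<close> by simp
  then have "m mod 4 = 1" by (simp add: cong_def)
  \<comment> \<open>Both \<open>m\<close> and \<open>m + k\<close> are 1 modulo 4, so 4 divides
    \<open>k\<close>.\<close>
  then have "even k'" using mod4(2) unfolding k' by presburger
  obtain e w where e: "e dvd b" "e > 0" "k' = e * w\<^sup>2"
    using coprime_factor_eq_divisor_times_square[of k' m b y'] mk' pos
    by (auto simp: mult.commute coprime_commute)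
  have "odd e" using e(1) ab by (meson dvd_trans)
  \<comment> \<open>With \<open>e\<close> odd, the factor 2 of \<open>k'\<close> must come from the
    square, so 4 divides \<open>k'\<close>.\<close>
  then have "even w" using e(3) \<open>even k'\<close> by simp
  then have "8 dvd k" unfolding k' e(3) by (auto simp: power2_eq_square)
  have "[a * x\<^sup>2 = m\<^sup>2] (mod 8)"
    unfolding mk(5) using \<open>8 dvd k\<close> by (simp add: cong_iff_dvd_diff power2_eq_square)
  moreover have "[a * x\<^sup>2 = a * 1] (mod 8)"
    by (intro cong_scalar_left odd_square_mod_8 \<open>odd x\<close>)
  ultimately have "[a = 1] (mod 8)"
    using odd_square_mod_8[OF \<open>odd m\<close>] by (metis cong_sym cong_trans mult.right_neutral)
  obtain q where q: "prime q" "q dvd b"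
    using prime_factor_int[of b] pos by auto
  have q4: "[q = 1] (mod 4)" using primes q by simp
  \<comment> \<open>This is \<open>nonres\<close> for the divisor \<open>d = q\<close>; it remains
    to exhibit a square root of \<open>a * x\<^sup>2\<close> modulo \<open>q\<close>.\<close>
  have "\<not> QuadRes q a"
    using nonres[OF \<open>[a = 1] (mod 8)\<close>] q prime_gt_1_int[of q]
    by (auto simp: quadratic_nonresidue_def)
  moreover have "QuadRes q (a * x\<^sup>2)"
  proof -
    have "q dvd m * k'" using q mk'(1) by simp
    then have "q dvd m \<or> q dvd k" using q(1) k' by (auto simp: prime_dvd_mult_iff)
    then show ?thesis
    proof
      assume "q dvd m"
      \<comment> \<open>Here \<open>a * x\<^sup>2\<close> is congruent to
        \<open>- k\<^sup>2\<close>, so a root \<open>t\<close> of -1 yields the root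
        \<open>t * k\<close>.\<close>
      obtain t where "[t\<^sup>2 = -1] (mod q)" using QuadRes_minus_one[OF q(1) q4] by (auto simp: QuadRes_def)
      then have "[t\<^sup>2 * k\<^sup>2 = -1 * k\<^sup>2] (mod q)" by (rule cong_scalar_right)
      moreover have "[-1 * k\<^sup>2 = a * x\<^sup>2] (mod q)"
        unfolding mk(5) using \<open>q dvd m\<close> by (simp add: cong_iff_dvd_diff power2_eq_square)
      ultimately have "[(t * k)\<^sup>2 = a * x\<^sup>2] (mod q)"
        by (metis cong_trans power_mult_distrib)
      then show ?thesis by (auto simp: QuadRes_def)
    next
      assume "q dvd k"
      then have "[m\<^sup>2 = a * x\<^sup>2] (mod q)"
        unfolding mk(5) by (simp add: cong_iff_dvd_diff power2_eq_square)
      then show ?thesis by (auto simp: QuadRes_def)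
    qed
  qed
  moreover have "coprime x q"
    using cop q(2) coprime_divisors[of x x q b] by simp
  ultimately show False by (simp add: QuadRes_mult_square_cancel)
qed

theorem theorem1:
  fixes s1 s2 :: int and n :: nat and p :: "nat \<Rightarrow> int"
  assumes "odd s1" and "squarefree s1" and "s1 > 1"
    and "odd s2" and "squarefree s2" and "s2 > 1"
    and "gcd s1 s2 = 1"
    and "n \<ge> 2"
    and "\<And>i. i \<in> {1..n} \<Longrightarrow> prime (p i)"
    and "s1 * s2 = (\<Prod>i = 1..n. p i)"
    and "[p 1 = 5] (mod 8)"
    and "\<And>i. i \<in> {2..n} \<Longrightarrow> [p i = 1] (mod 8)"
    and "[s1 = 1] (mod 8) \<Longrightarrow> (\<forall>d. d > 1 \<and> d dvd s2 \<longrightarrow> quadratic_nonresidue s1 d)"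
    and "[s2 = 1] (mod 8) \<Longrightarrow> (\<forall>d. d > 1 \<and> d dvd s1 \<longrightarrow> quadratic_nonresidue s2 d)"
  shows "\<not> (\<exists>x y z :: int. x > 0 \<and> y > 0 \<and> z > 0 \<and> gcd (s1 * x) (s2 * y) = 1
             \<and> s1 ^ 2 * x ^ 4 + s2 ^ 2 * y ^ 4 = z ^ 2)"
proof
  assume "\<exists>x y z :: int. x > 0 \<and> y > 0 \<and> z > 0 \<and> gcd (s1 * x) (s2 * y) = 1
             \<and> s1 ^ 2 * x ^ 4 + s2 ^ 2 * y ^ 4 = z ^ 2"
  then obtain x y z :: int where xyz: "x > 0" "y > 0" "z > 0"
      and cop: "coprime (s1 * x) (s2 * y)"
      and eq: "s1\<^sup>2 * x ^ 4 + s2\<^sup>2 * y ^ 4 = z\<^sup>2"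
    by (auto simp: coprime_iff_gcd_eq_1)
  have primes: "[q = 1] (mod 4)" if q: "prime q" "q dvd s1 * s2" for q
  proof -
    obtain i where i: "i \<in> {1..n}" "q dvd p i"
      using q assms(10) prime_dvd_prod_iff[of "{1..n}" q p] by (metis finite_atLeastAtMost)
    then have "q = p i" using q assms(9) by (metis primes_dvd_imp_eq)
    moreover have "p i mod 8 = 5 \<or> p i mod 8 = 1"
      using i assms(11,12)[unfolded cong_def] by (cases "i = 1") auto
    ultimately have "q mod 8 = 5 \<or> q mod 8 = 1" by simp
    \<comment> \<open>The residues 1 and 5 modulo 8 coincide modulo 4.\<close>
    then have "q mod 4 = 1" by presburger
    then show ?thesis by (simp add: cong_def)
  qed
  \<comment> \<open>If both were odd, \<open>z\<^sup>2\<close> would be a sum of two odd squares,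
    hence 2 modulo 8; but an even square is a multiple of 4.\<close>
  have "even x \<or> even y"
  proof (rule ccontr)
    assume "\<not> (even x \<or> even y)"
    then have "odd (s1 * x\<^sup>2)" "odd (s2 * y\<^sup>2)" using assms by auto
    then have "[(s1 * x\<^sup>2)\<^sup>2 + (s2 * y\<^sup>2)\<^sup>2 = 1 + 1] (mod 8)"
      by (intro cong_add odd_square_mod_8)
    then have *: "[z\<^sup>2 = 2] (mod 8)"
      using eq by (simp add: power_mult_distrib flip: power_mult)
    have "even v" if "[v = 2] (mod 8)" for v :: int
    proof -
      have "v mod 8 = 2" using that by (simp add: cong_def)
      then show ?thesis by presburger
    qed
    from this[OF *] have "even z" by simp
    then obtain w where "z = 2 * w" by auto
    then have "[4 * w\<^sup>2 = 2] (mod 8)" using * by (simp add: power_mult_distrib)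
    moreover have "\<not> [4 * v = 2] (mod 8)" for v :: int
      by (simp add: cong_def) presburger
    ultimately show False by blast
  qed
  then show False
  proof
    assume "even x"
    then show False
      using no_solution_even[of s2 s1 y x z] assms xyz cop eq primes
      by (simp add: ac_simps)
  next
    assume "even y"
    then show False
      using no_solution_even[of s1 s2 x y z] assms xyz cop eq primes by simp
  qed
qed

end
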